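(* Let $\Omega\subset\mathbb{R}^2$ be a (possibly nonconvex) bounded region, and let $\{P^i\}_{i=1}^d$ be a polyhedral partition of $\Omega$, i.e. a finite family of polytopes with $\bigcup_{i=1}^d P^i=\Omega$ whose relative interiors do not overlap. Let $\mathscr{S}=\{\mathrm{ext}(P^i)\}_{i=1}^d$ and $J=\bigcup_{S\in\mathscr{S}}S$, and assume that $\mathscr{S}$ is irredundant and that there are no internal vertices, i.e. for all $i\in\{1,\dots,d\}$ and all $v\in J$, $v\in P^i \Longleftrightarrow v\in\mathrm{ext}(P^i)$. Then an independent branching scheme for $\mathrm{CDC}(\mathscr{S})$ exists if and only if no infeasible set $T\subseteq J$ with $|T|=3$ is a minimal infeasible set.
   Context: A polytope is a bounded polyhedron, i.e. the convex hull of a finite set of points; $\mathrm{ext}(P)$ is the set of extreme points (vertices) of $P$. For a finite ground set $J$, $\Delta^J=\{\lambda\in\mathbb{R}_{+}^{|J|}:\sum_{v\in J}\lambda_v=1\}$ is the standard simplex. For $S\subseteq J$, $Q(S)=\{\lambda\in\Delta^J:\lambda_v=0 \text{ for all } v\in J\setminus S\}$. For a family $\mathscr{S}\subseteq 2^J$, the combinatorial disjunctive constraint is the set $\mathrm{CDC}(\mathscr{S})=\bigcup_{S\in\mathscr{S}}Q(S)$. The family $\mathscr{S}$ is irredundant if there are no distinct $S,T\in\mathscr{S}$ with $S\subseteq T$. A set $T\subseteq J$ is feasible (with respect to $\mathrm{CDC}(\mathscr{S})$) if $T\subseteq S$ for some $S\in\mathscr{S}$, and infeasible otherwise. A minimal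 infeasible set is an infeasible set that contains no infeasible set as a proper subset. An independent branching (IB) scheme for $\mathrm{CDC}(\mathscr{S})$ (with two alternatives per level) is a finite family of pairs $(L^j,R^j)$, $j\in\{1,\dots,t\}$, with $L^j,R^j\subseteq J$, such that $\mathrm{CDC}(\mathscr{S})=\bigcap_{j=1}^t\left(Q(L^j)\cup Q(R^j)\right)$. *)

theory Defs
  imports "HOL-Analysis.Analysis"
begin

definition extreme_points :: "'a::real_vector set \<Rightarrow> 'a set" where
  "extreme_points P = {x. x extreme_point_of P}"

definition polyhedral_partition ::
    "nat \<Rightarrow> (nat \<Rightarrow> 'a::euclidean_space set) \<Rightarrow> 'a set \<Rightarrow> bool" where
  "polyhedral_partition d P \<Omega> \<longleftrightarrow>
     (\<forall>i\<in>{1..d}. polytope (P i)) \<and>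
     (\<Union>i\<in>{1..d}. P i) = \<Omega> \<and>
     disjoint_family_on (\<lambda>i. rel_interior (P i)) {1..d}"

(* Vectors of R^J are represented by extensional functions on J. *)
definition std_simplex :: "'v set \<Rightarrow> ('v \<Rightarrow> real) set" where
  "std_simplex J = {lam. lam \<in> J \<rightarrow>\<^sub>E {0..} \<and> (\<Sum>v\<in>J. lam v) = 1}"

definition Q :: "'v set \<Rightarrow> 'v set \<Rightarrow> ('v \<Rightarrow> real) set" where
  "Q J S = {lam \<in> std_simplex J. \<forall>v\<in>J - S. lam v = 0}"

definition CDC :: "'v set \<Rightarrow> 'v set set \<Rightarrow> ('v \<Rightarrow> real) set" where
  "CDC J \<S> = (\<Union>S\<in>\<S>. Q J S)"

definition irredundant :: "'v set set \<Rightarrow> bool" where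
  "irredundant \<S> \<longleftrightarrow> \<not> (\<exists>S\<in>\<S>. \<exists>T\<in>\<S>. S \<noteq> T \<and> S \<subseteq> T)"

definition feasible :: "'v set \<Rightarrow> 'v set set \<Rightarrow> 'v set \<Rightarrow> bool" where
  "feasible J \<S> T \<longleftrightarrow> T \<subseteq> J \<and> (\<exists>S\<in>\<S>. T \<subseteq> S)"

definition infeasible :: "'v set \<Rightarrow> 'v set set \<Rightarrow> 'v set \<Rightarrow> bool" where
  "infeasible J \<S> T \<longleftrightarrow> T \<subseteq> J \<and> \<not> feasible J \<S> T"

definition minimal_infeasible :: "'v set \<Rightarrow> 'v set set \<Rightarrow> 'v set \<Rightarrow> bool" where
  "minimal_infeasible J \<S> T \<longleftrightarrow>
     infeasible J \<S> T \<and> \<not> (\<exists>T'. T' \<subset> T \<and> infeasible J \<S> T')"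

(* The intersection over the levels is taken inside the simplex, so that for t = 0 it is
   the whole simplex and not UNIV; for t > 0 the extra intersection has no effect. *)
definition ib_scheme ::
    "'v set \<Rightarrow> 'v set set \<Rightarrow> nat \<Rightarrow> (nat \<Rightarrow> 'v set) \<Rightarrow> (nat \<Rightarrow> 'v set) \<Rightarrow> bool" where
  "ib_scheme J \<S> t L R \<longleftrightarrow>
     (\<forall>j\<in>{1..t}. L j \<subseteq> J \<and> R j \<subseteq> J) \<and>
     CDC J \<S> = std_simplex J \<inter> (\<Inter>j\<in>{1..t}. Q J (L j) \<union> Q J (R j))"

end

theory Submission
  imports Defs
begin

text \<open>For a point of the simplex only its support matters: it lies in \<open>Q(S)\<close> iff its support is
  contained in \<open>S\<close>, and in the disjunctive constraint iff its support is feasible. Hence a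
  two-alternative scheme exists iff every minimal infeasible set has at most two elements, the
  scheme branching on \<open>J - {u}\<close> and \<open>J - {v}\<close> for each infeasible pair \<open>{u, v}\<close>.

  In the plane, a minimal infeasible set \<open>T\<close> never has four elements or more. For each \<open>v \<in> T\<close>
  some polytope \<open>P v\<close> has all of \<open>T - {v}\<close> among its vertices, so no three points of \<open>T\<close> are
  collinear. For \<open>u \<noteq> v\<close>, a line separating \<open>P u\<close> from \<open>P v\<close> passes through all points of
  \<open>T - {u, v}\<close>, with \<open>u\<close> and \<open>v\<close> strictly on opposite sides. Evaluating an affine dependence of
  four points of \<open>T\<close> on these lines shows that its coefficients all have the same sign, although
  they sum to zero.\<close>

lemma Q_iff_support:
  "lam \<in> Q J S \<longleftrightarrow> lam \<in> std_simplex J \<and> {v\<in>J. lam v \<noteq> 0} \<subseteq> S"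
  by (auto simp: Q_def)

lemma CDC_iff_feasible_support:
  "lam \<in> CDC J \<S> \<longleftrightarrow> lam \<in> std_simplex J \<and> feasible J \<S> {v\<in>J. lam v \<noteq> 0}"
  by (auto simp: CDC_def Q_iff_support feasible_def)

text \<open>Uniform weights on \<open>T\<close> suffice. This is how a statement about points of the
  constraint is turned back into one about sets.\<close>

lemma std_simplex_with_support:
  assumes "finite J" "T \<subseteq> J" "T \<noteq> {}"
  obtains lam where "lam \<in> std_simplex J" "{v\<in>J. lam v \<noteq> 0} = T"
proof
  let ?lam = "\<lambda>v\<in>J. if v \<in> T then 1 / real (card T) else 0"
  have fin: "finite T" using assms finite_subset by blast
  then have pos: "real (card T) > 0" using assms by (simp add: card_gt_0_iff)
  have "(\<Sum>v\<in>J. ?lam v) = (\<Sum>v\<in>T. 1 / real (card T))"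
    using assms by (intro sum.mono_neutral_cong_right) auto
  then show "?lam \<in> std_simplex J"
    using pos by (auto simp: std_simplex_def)
  show "{v\<in>J. ?lam v \<noteq> 0} = T"
    using pos assms by auto
qed

lemma infeasible_contains_minimal:
  assumes "finite T" "infeasible J \<S> T"
  obtains M where "M \<subseteq> T" "minimal_infeasible J \<S> M"
proof -
  have "\<exists>M\<subseteq>T. minimal_infeasible J \<S> M"
    using assms
  proof (induction T rule: finite_psubset_induct)
    case (psubset T)
    show ?case
    proof (cases "minimal_infeasible J \<S> T")
      case False
      then obtain T' where T': "T' \<subset> T" "infeasible J \<S> T'"
        using psubset.prems by (auto simp: minimal_infeasible_def)
      then obtain M where "M \<subseteq> T'" "minimal_infeasible J \<S> M"
        using psubset.IH[OF T'] by blast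
      then show ?thesis using T'(1) by blast
    qed blast
  qed
  then show ?thesis using that by blast
qed

lemma minimal_infeasible_psubset_feasible:
  assumes "minimal_infeasible J \<S> T" "T' \<subset> T"
  shows "feasible J \<S> T'"
proof -
  have "\<not> infeasible J \<S> T'" "T \<subseteq> J"
    using assms unfolding minimal_infeasible_def infeasible_def by blast+
  then show ?thesis using assms(2) unfolding infeasible_def by blast
qed

text \<open>A level that cuts off a point with support \<open>T\<close> does so because of just two
  elements, one missing from \<open>L j\<close> and one from \<open>R j\<close>. It therefore also
  cuts off the points supported on these two, whose support would be feasible if \<open>T\<close>
  were larger.\<close>

lemma ib_scheme_minimal_infeasible_card_le_2:
  assumes "finite J" and ib: "ib_scheme J \<S> t L R" and T: "minimal_infeasible J \<S> T"
  shows "card T \<le> 2"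
proof (rule ccontr)
  assume "\<not> card T \<le> 2"
  then have card: "card T > 2" by simp
  have TJ: "T \<subseteq> J" and "\<not> feasible J \<S> T"
    using T by (auto simp: minimal_infeasible_def infeasible_def)
  moreover have "T \<noteq> {}" using card by auto
  then obtain lam where lam: "lam \<in> std_simplex J" "{v\<in>J. lam v \<noteq> 0} = T"
    using std_simplex_with_support[OF \<open>finite J\<close> TJ] by blast
  ultimately have "lam \<notin> CDC J \<S>" by (simp add: CDC_iff_feasible_support)
  then obtain j where j: "j \<in> {1..t}" "lam \<notin> Q J (L j) \<union> Q J (R j)"
    using ib lam by (auto simp: ib_scheme_def)
  then obtain u w where uw: "u \<in> T" "u \<notin> L j" "w \<in> T" "w \<notin> R j"
    using lam by (auto simp: Q_iff_support)
  have "card {u, w} \<le> 2" by (simp add: card_insert_if)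
  then have "{u, w} \<subset> T" using uw card by auto
  then have feas: "feasible J \<S> {u, w}"
    using T minimal_infeasible_psubset_feasible by blast
  obtain mu where mu: "mu \<in> std_simplex J" "{v\<in>J. mu v \<noteq> 0} = {u, w}"
    using std_simplex_with_support[of J "{u, w}"] \<open>finite J\<close> uw TJ by blast
  then have "mu \<in> CDC J \<S>" using feas by (simp add: CDC_iff_feasible_support)
  then have "mu \<in> Q J (L j) \<union> Q J (R j)" using ib j(1) by (auto simp: ib_scheme_def)
  then show False using mu uw by (auto simp: Q_iff_support)
qed

lemma ib_scheme_exists:
  assumes "finite J" and J: "J = \<Union>\<S>"
    and card: "\<And>T. minimal_infeasible J \<S> T \<Longrightarrow> card T \<le> 2"
  shows "\<exists>t L R. ib_scheme J \<S> t L R"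
proof -
  define I where "I = {(u, w). u \<in> J \<and> w \<in> J \<and> \<not> feasible J \<S> {u, w}}"
  have "finite I"
    by (rule finite_subset[of _ "J \<times> J"]) (auto simp: I_def \<open>finite J\<close>)
  then obtain h where h: "bij_betw h {1..card I} I"
    using ex_bij_betw_nat_finite_1 by blast
  then have range: "h ` {1..card I} = I" by (simp add: bij_betw_def)
  have "ib_scheme J \<S> (card I) (\<lambda>j. J - {fst (h j)}) (\<lambda>j. J - {snd (h j)})"
    unfolding ib_scheme_def
  proof (intro conjI ballI)
    let ?B = "\<lambda>p. Q J (J - {fst p}) \<union> Q J (J - {snd p})"
    have "lam \<in> CDC J \<S> \<longleftrightarrow> (\<forall>p\<in>I. lam \<in> ?B p)" if lam: "lam \<in> std_simplex J" for lam
    proof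
      assume "lam \<in> CDC J \<S>"
      then show "\<forall>p\<in>I. lam \<in> ?B p"
        by (auto simp: CDC_iff_feasible_support Q_iff_support feasible_def I_def)
    next
      assume B: "\<forall>p\<in>I. lam \<in> ?B p"
      show "lam \<in> CDC J \<S>"
      proof (rule ccontr)
        let ?T = "{v\<in>J. lam v \<noteq> 0}"
        assume "lam \<notin> CDC J \<S>"
        then have "infeasible J \<S> ?T"
          using lam by (auto simp: CDC_iff_feasible_support infeasible_def)
        then obtain M where M: "M \<subseteq> ?T" "minimal_infeasible J \<S> M"
          using infeasible_contains_minimal[of ?T] \<open>finite J\<close> by auto
        have nf: "\<not> feasible J \<S> M" using M by (auto simp: minimal_infeasible_def infeasible_def)
        \<comment> \<open>For an empty family even the empty set is infeasible. This is harmless,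
          since then \<open>J\<close> is empty and the simplex has no point
          \<open>lam\<close>.\<close>
        have "J \<noteq> {}" using lam by (auto simp: std_simplex_def)
        then have "M \<noteq> {}" using nf J by (auto simp: feasible_def)
        moreover have "finite M" using M \<open>finite J\<close> by (auto intro: finite_subset)
        ultimately have "card M = 1 \<or> card M = 2"
          using card[OF M(2)] card_gt_0_iff[of M] by linarith
        then obtain u w where uw: "M = {u, w}"
          by (metis card_1_singletonE card_2_iff insert_absorb2)
        then have "(u, w) \<in> I" using nf M by (auto simp: I_def)
        with B have "lam \<in> ?B (u, w)" by blast
        then show False using M(1) uw by (auto simp: Q_iff_support)
      qed
    qed
    moreover have "CDC J \<S> \<subseteq> std_simplex J" by (auto simp: CDC_iff_feasible_support)
    ultimately have "CDC J \<S> = std_simplex J \<inter> (\<Inter>p\<in>I. ?B p)" by blast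
    also have "(\<Inter>p\<in>I. ?B p) = (\<Inter>j\<in>{1..card I}. ?B (h j))"
      by (subst range[symmetric]) (simp only: image_image)
    finally show "CDC J \<S> = std_simplex J \<inter> (\<Inter>j\<in>{1..card I}. ?B (h j))" .
  qed auto
  then show ?thesis by blast
qed

text \<open>Of three distinct collinear points one lies in the open segment between the other two,
  which extremality forbids.\<close>

lemma extreme_points_not_collinear:
  fixes a b c :: "'a::euclidean_space"
  assumes "{a, b, c} \<subseteq> extreme_points S" "a \<noteq> b" "a \<noteq> c" "b \<noteq> c"
  shows "\<not> collinear {a, b, c}"
proof
  have "\<not> between (y, z) x" if "{x, y, z} \<subseteq> extreme_points S" "x \<noteq> y" "x \<noteq> z" "y \<noteq> z" for x y z
    using that by (auto simp: extreme_points_def extreme_point_of_def between_mem_segment open_segment_def)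
  moreover assume "collinear {a, b, c}"
  ultimately show False using assms by (auto simp: collinear_between_cases)
qed

lemma collinear_hyperplane_2:
  fixes a :: "real^2"
  assumes "a \<noteq> 0"
  shows "collinear {x. a \<bullet> x = b}"
  using assms by (simp add: collinear_aff_dim)

text \<open>The relative interiors are disjoint convex sets, hence weakly separable. The closed
  half-spaces then contain their closures, and by convexity these are the closures of
  \<open>S\<close> and \<open>T\<close>.\<close>

lemma disjoint_rel_interiors_separating_hyperplane:
  fixes S T :: "'a::euclidean_space set"
  assumes "convex S" "convex T" "S \<noteq> {}" "T \<noteq> {}" "rel_interior S \<inter> rel_interior T = {}"
  obtains a b where "a \<noteq> 0" "\<And>x. x \<in> S \<Longrightarrow> a \<bullet> x \<le> b" "\<And>x. x \<in> T \<Longrightarrow> a \<bullet> x \<ge> b"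
proof -
  obtain a b where ab: "a \<noteq> 0" "\<forall>x\<in>rel_interior S. a \<bullet> x \<le> b" "\<forall>x\<in>rel_interior T. a \<bullet> x \<ge> b"
    using assms separating_hyperplane_sets[of "rel_interior S" "rel_interior T"]
    by (auto simp: convex_rel_interior rel_interior_eq_empty)
  have "closure (rel_interior S) \<subseteq> {x. a \<bullet> x \<le> b}"
    "closure (rel_interior T) \<subseteq> {x. a \<bullet> x \<ge> b}"
    using ab by (intro closure_minimal closed_halfspace_le closed_halfspace_ge; blast)+
  then have "S \<subseteq> {x. a \<bullet> x \<le> b}" "T \<subseteq> {x. a \<bullet> x \<ge> b}"
    using assms(1,2) closure_subset[of S] closure_subset[of T]
    by (simp_all only: convex_closure_rel_interior)
  then show ?thesis using ab that by blast
qed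

lemma minimal_infeasible_card_le_3:
  fixes P :: "'i \<Rightarrow> (real^2) set"
  assumes convex: "\<And>i. i \<in> I \<Longrightarrow> convex (P i)"
    and disj: "disjoint_family_on (\<lambda>i. rel_interior (P i)) I"
    and T: "minimal_infeasible J ((\<lambda>i. extreme_points (P i)) ` I) T"
  shows "card T \<le> 3"
proof (rule ccontr)
  assume "\<not> card T \<le> 3"
  \<comment> \<open>Four is the dimension plus two, which forces an affine dependence; it also
    leaves two points to span a line once \<open>u\<close> and \<open>v\<close> are removed.\<close>
  then obtain F where F: "F \<subseteq> T" "card F = 4" "finite F"
    using obtain_subset_with_card_n[of 4 T] by auto
  have "\<exists>p\<in>I. T - {v} \<subseteq> extreme_points (P p)" if "v \<in> T" for v
    using minimal_infeasible_psubset_feasible[OF T, of "T - {v}"] that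
    by (auto simp: feasible_def)
  then obtain p where pI: "\<And>v. v \<in> T \<Longrightarrow> p v \<in> I"
    and pT: "\<And>v. v \<in> T \<Longrightarrow> T - {v} \<subseteq> extreme_points (P (p v))"
    by metis
  have ext_in: "extreme_points (P i) \<subseteq> P i" for i
    by (auto simp: extreme_points_def extreme_point_of_def)
  have infeas: "\<not> T \<subseteq> extreme_points (P (p v))" if "v \<in> T" for v
    using T pI that by (auto simp: minimal_infeasible_def infeasible_def feasible_def)
  have noncollinear: "\<not> collinear {x, y, z}"
    if "{x, y, z} \<subseteq> T" "x \<noteq> y" "x \<noteq> z" "y \<noteq> z" "w \<in> T" "w \<notin> {x, y, z}" for w x y z
    using extreme_points_not_collinear[of x y z] pT[of w] that by blast
  have sep: "\<exists>a b. (\<forall>x\<in>F - {u, v}. a \<bullet> x = b) \<and> a \<bullet> u > b \<and> a \<bullet> v < b"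
    if uv: "u \<in> F" "v \<in> F" "u \<noteq> v" for u v
  proof -
    have uvT: "u \<in> T" "v \<in> T" using uv F by auto
    \<comment> \<open>A common polytope would have all of \<open>T\<close> among its
      vertices.\<close>
    then have "p u \<noteq> p v" using pT[of u] pT[of v] infeas[of u] uv(3) by auto
    then have "rel_interior (P (p u)) \<inter> rel_interior (P (p v)) = {}"
      using disj pI uvT by (auto simp: disjoint_family_on_def)
    \<comment> \<open>The roles cross: \<open>p u\<close> is chosen for \<open>T - {u}\<close>, so
      its polytope contains \<open>v\<close>, and \<open>u\<close> ends up on the side of
      \<open>P (p v)\<close>.\<close>
    moreover have vu: "v \<in> P (p u)" "u \<in> P (p v)" using pT ext_in uv uvT by blast+
    ultimately obtain a b where ab: "a \<noteq> 0" "\<And>x. x \<in> P (p u) \<Longrightarrow> a \<bullet> x \<le> b"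
        "\<And>x. x \<in> P (p v) \<Longrightarrow> a \<bullet> x \<ge> b"
      using disjoint_rel_interiors_separating_hyperplane[of "P (p u)" "P (p v)"] convex pI uvT
      by (metis empty_iff)
    have on: "\<forall>x\<in>F - {u, v}. a \<bullet> x = b"
    proof
      fix x assume "x \<in> F - {u, v}"
      then have "x \<in> P (p u)" "x \<in> P (p v)" using pT uvT ext_in F by blast+
      then show "a \<bullet> x = b" using ab by (meson order_antisym)
    qed
    have "card (F - {u, v}) = 2" using F uv by (simp add: card_Diff_subset)
    then obtain y z where yz: "F - {u, v} = {y, z}" "y \<noteq> z" by (meson card_2_iff)
    then have yzF: "y \<in> F" "z \<in> F" "y \<notin> {u, v}" "z \<notin> {u, v}" by blast+
    \<comment> \<open>Otherwise the line contains three points of \<open>T\<close> that are all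
      vertices of the polytope chosen for the other one of \<open>u\<close> and
      \<open>v\<close>.\<close>
    have off: "a \<bullet> w \<noteq> b" if w: "w = u \<or> w = v" for w
    proof
      assume "a \<bullet> w = b"
      then have "{w, y, z} \<subseteq> {x. a \<bullet> x = b}" using on yz(1) by auto
      then have "collinear {w, y, z}"
        using collinear_hyperplane_2[OF ab(1)] collinear_subset by blast
      then show False
        using noncollinear[of w y z u] noncollinear[of w y z v] w yz yzF uvT uv F by auto
    qed
    have "a \<bullet> u > b" "a \<bullet> v < b"
      using off[of u] off[of v] ab(2)[OF vu(1)] ab(3)[OF vu(2)] by auto
    then show ?thesis using on by blast
  qed
  have "affine_dependent F"
    using F by (intro affine_dependent_biggerset) auto
  then obtain m where m: "sum m F = 0" "(\<Sum>v\<in>F. m v *\<^sub>R v) = 0" and nz: "\<exists>v\<in>F. m v \<noteq> 0"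
    using affine_dependent_explicit_finite[OF F(3)] by blast
  have same_sign: "m v > 0" if uv: "u \<in> F" "v \<in> F" and "m u > 0" for u v
  proof (cases "u = v")
    case False
    then obtain a b where ab: "\<forall>x\<in>F - {u, v}. a \<bullet> x = b" "a \<bullet> u > b" "a \<bullet> v < b"
      using sep uv by blast
    \<comment> \<open>An affine dependence annihilates every affine function. This one vanishes on
      \<open>F - {u, v}\<close>, so only the terms of \<open>u\<close> and \<open>v\<close> remain;
      its values there have opposite signs, so \<open>m u\<close> and \<open>m v\<close> have the
      same sign.\<close>
    have "(\<Sum>x\<in>F. m x * (a \<bullet> x - b)) = a \<bullet> (\<Sum>x\<in>F. m x *\<^sub>R x) - b * sum m F"
      by (simp add: inner_sum_right sum_distrib_left sum_subtractf right_diff_distrib mult.commute)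
    also have "\<dots> = 0" using m by simp
    also have "(\<Sum>x\<in>F. m x * (a \<bullet> x - b)) = (\<Sum>x\<in>{u, v}. m x * (a \<bullet> x - b))"
      using F uv ab by (intro sum.mono_neutral_right) auto
    finally have "m u * (a \<bullet> u - b) = m v * (b - a \<bullet> v)"
      using False by (simp add: algebra_simps)
    moreover have "m u * (a \<bullet> u - b) > 0" using ab that by simp
    ultimately show ?thesis using ab by (simp add: zero_less_mult_iff)
  qed (use that in simp)
  have "\<exists>u\<in>F. m u > 0"
  proof (rule ccontr)
    assume "\<not> (\<exists>u\<in>F. m u > 0)"
    then have "\<forall>u\<in>F. m u \<le> 0" by auto
    then have "\<forall>u\<in>F. m u = 0" using m(1) F sum_nonneg_eq_0_iff[of F "\<lambda>v. - m v"] by (simp add: sum_negf)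
    then show False using nz by blast
  qed
  then have "\<forall>v\<in>F. m v > 0" using same_sign by blast
  then have "sum m F > 0" using F by (intro sum_pos) auto
  then show False using m by simp
qed

theorem corollary1:
  fixes \<Omega> :: "(real^2) set"
    and d :: nat
    and P :: "nat \<Rightarrow> (real^2) set"
    and \<S> :: "(real^2) set set"
    and J :: "(real^2) set"
  assumes "bounded \<Omega>"
    and "polyhedral_partition d P \<Omega>"
    and "\<S> = (\<lambda>i. extreme_points (P i)) ` {1..d}"
    and "J = \<Union>\<S>"
    and "irredundant \<S>"
    and no_internal_vertices:
      "\<forall>i\<in>{1..d}. \<forall>v\<in>J. v \<in> P i \<longleftrightarrow> v \<in> extreme_points (P i)"
  shows "(\<exists>t L R. ib_scheme J \<S> t L R) \<longleftrightarrow>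
         (\<forall>T\<subseteq>J. infeasible J \<S> T \<and> card T = 3 \<longrightarrow> \<not> minimal_infeasible J \<S> T)"
proof -
  have poly: "\<And>i. i \<in> {1..d} \<Longrightarrow> polytope (P i)"
    and disj: "disjoint_family_on (\<lambda>i. rel_interior (P i)) {1..d}"
    using assms(2) by (auto simp: polyhedral_partition_def)
  have "finite J"
    using poly unfolding assms(3,4) extreme_points_def
    by (auto intro!: finite_polyhedron_extreme_points polytope_imp_polyhedron)
  \<comment> \<open>Once larger sizes are excluded, forbidding size three leaves only minimal
    infeasible sets of at most two elements.\<close>
  have le3: "card T \<le> 3" if "minimal_infeasible J \<S> T" for T
    using minimal_infeasible_card_le_3[of "{1..d}" P J T] that poly disj assms(3)
    by (simp add: polytope_imp_convex)
  show ?thesis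
  proof
    assume "\<exists>t L R. ib_scheme J \<S> t L R"
    then show "\<forall>T\<subseteq>J. infeasible J \<S> T \<and> card T = 3 \<longrightarrow> \<not> minimal_infeasible J \<S> T"
      using ib_scheme_minimal_infeasible_card_le_2[OF \<open>finite J\<close>, of \<S>] by force
  next
    assume no3: "\<forall>T\<subseteq>J. infeasible J \<S> T \<and> card T = 3 \<longrightarrow> \<not> minimal_infeasible J \<S> T"
    have "card T \<le> 2" if "minimal_infeasible J \<S> T" for T
    proof -
      have "infeasible J \<S> T" "T \<subseteq> J"
        using that unfolding minimal_infeasible_def infeasible_def by blast+
      then have "card T \<noteq> 3" using no3 that by blast
      then show ?thesis using le3[OF that] by simp
    qed
    then show "\<exists>t L R. ib_scheme J \<S> t L R"
      using ib_scheme_exists[OF \<open>finite J\<close> assms(4)] by blast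
  qed
qed

end
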